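(* Let $\alpha>-1$ and let $n\ge0$ be an integer. Let $$W_n(t):=1+\frac{2t}{R_n(t)},\qquad R_n(t)=2n+1+2\alpha-2t\big(\beta_n(t)+\beta_{n+1}(t)\big).$$ Then $W_n(t)$ satisfies the Painlevé V equation (prime denoting $d/dt$) $$W_n''=\frac{(3W_n-1)(W_n')^2}{2W_n(W_n-1)}-\frac{W_n'}{t}+\frac{(W_n-1)^2}{t^2}\left(\mu_1W_n+\frac{\mu_2}{W_n}\right)+\frac{\mu_3W_n}{t}+\frac{\mu_4W_n(W_n+1)}{W_n-1}$$ with the parameters $$\mu_1=\frac{\alpha^2}{2},\qquad\mu_2=-\frac18,\qquad\mu_3=\frac12(2n+1+2\alpha),\qquad\mu_4=-\frac12,$$ at all real $t$ where the expressions are defined (i.e. $t\neq0$, $R_n(t)\ne0$, $W_n(t)\neq0$). The initial conditions are $$W_n(0)=1,\qquad W_n'(0)=\frac{2}{2n+1+2\alpha}$$ (for $2n+1+2\alpha\neq0$).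
   Context: For $\alpha>-1$ and $t\in\mathbb{R}$ let $w(x,t)=(1-x^2)^{\alpha}e^{-tx^2}$, $x\in[-1,1]$. Let $P_n(x,t)$, $n=0,1,2,\ldots$, be the monic polynomials of degree $n$ orthogonal with respect to $w$: $\int_{-1}^1P_m(x,t)P_n(x,t)w(x,t)\,dx=h_n(t)\delta_{mn}$. Since $w$ is even they satisfy $xP_n(x,t)=P_{n+1}(x,t)+\beta_n(t)P_{n-1}(x,t)$ with $P_0=1$, $P_{-1}=0$ and $\beta_0(t):=0$; for $n\ge1$, $\beta_n(t)=h_n(t)/h_{n-1}(t)$. *)

theory Defs
  imports "HOL-Analysis.Analysis" "HOL-Computational_Algebra.Polynomial"
begin

(* At x = -1 and x = 1 the library convention 0 powr a = 0 applies, also for alpha <= 0;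
   this changes the weight on a null set only. *)
definition weight :: "real \<Rightarrow> real \<Rightarrow> real \<Rightarrow> real" where
  "weight \<alpha> t x = (1 - x\<^sup>2) powr \<alpha> * exp (- t * x\<^sup>2)"

(* For a nonnegative integrable weight w that is positive almost everywhere on [-1,1], such a
   pair (P, h) exists and is unique.  In particular h n is the squared norm of P n (case m = n). *)
definition monic_orthogonal :: "(real \<Rightarrow> real) \<Rightarrow> (nat \<Rightarrow> real poly) \<Rightarrow> (nat \<Rightarrow> real) \<Rightarrow> bool" where
  "monic_orthogonal w P h \<longleftrightarrow>
     (\<forall>n. degree (P n) = n \<and> lead_coeff (P n) = 1) \<and>
     (\<forall>m n. (LBINT x:{-1..1}. poly (P m) x * poly (P n) x * w x) = (if m = n then h n else 0))"

(* The coefficients of the three-term recurrence x P_n = P_(n+1) + beta_n P_(n-1), P_(-1) = 0. *)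
definition rec_coeff :: "(nat \<Rightarrow> real \<Rightarrow> real) \<Rightarrow> nat \<Rightarrow> real \<Rightarrow> real" where
  "rec_coeff h n t = (if n = 0 then 0 else h n t / h (n - 1) t)"

definition R_fun :: "real \<Rightarrow> (nat \<Rightarrow> real \<Rightarrow> real) \<Rightarrow> nat \<Rightarrow> real \<Rightarrow> real" where
  "R_fun \<alpha> h n t =
     2 * real n + 1 + 2 * \<alpha> - 2 * t * (rec_coeff h n t + rec_coeff h (n + 1) t)"

(* Meaningful only where R_fun is nonzero. *)
definition W_fun :: "real \<Rightarrow> (nat \<Rightarrow> real \<Rightarrow> real) \<Rightarrow> nat \<Rightarrow> real \<Rightarrow> real" where
  "W_fun \<alpha> h n t = 1 + 2 * t / R_fun \<alpha> h n t"

(* Since deriv is total, the existence of y' near t and of y'' at t is part of the definition. *)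
definition painleve_V_at ::
    "real \<Rightarrow> real \<Rightarrow> real \<Rightarrow> real \<Rightarrow> (real \<Rightarrow> real) \<Rightarrow> real \<Rightarrow> bool" where
  "painleve_V_at \<mu>\<^sub>1 \<mu>\<^sub>2 \<mu>\<^sub>3 \<mu>\<^sub>4 y t \<longleftrightarrow>
     (\<forall>\<^sub>F s in nhds t. y field_differentiable (at s)) \<and>
     deriv y field_differentiable (at t) \<and>
     deriv (deriv y) t =
       (3 * y t - 1) * (deriv y t)\<^sup>2 / (2 * y t * (y t - 1))
       - deriv y t / t
       + (y t - 1)\<^sup>2 / t\<^sup>2 * (\<mu>\<^sub>1 * y t + \<mu>\<^sub>2 / y t)
       + \<mu>\<^sub>3 * y t / t
       + \<mu>\<^sub>4 * y t * (y t + 1) / (y t - 1)"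

end

theory Submission
  imports Defs
begin

text \<open>
  Write $L_t(p) = \<integral> p\,w(\cdot,t)$ and $r_n = n - 2t\<beta>_n$, so that
  $R_n = r_n + r_{n+1} + 2\<alpha>$.  The proof combines an evolution in $t$ with an algebraic constraint,
  which together close up into a first-order system for two functions.

  The evolution is elementary: $\<partial>w/\<partial>t = -x^2 w$ gives
  $h_n' = -(\<beta>_n + \<beta>_{n+1}) h_n$ (\<open>norm_has_derivative\<close>) and hence the Volterra lattice
  $\<beta>_n' = \<beta>_n(\<beta>_{n-1} - \<beta>_{n+1})$ (\<open>volterra\<close>).

  The constraint comes from the differential equation of $w$ in $x$.  Integration by parts yields
  the structure relation
  $(1-x^2) P_n' + r_n x P_n = \<beta>_n (R_n + 2t(1-x^2)) P_{n-1}$ (\<open>structure_relation\<close>).  At $x = 1$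
  the derivative drops out, and two consecutive instances form a homogeneous linear system for
  $(P_n(1), P_{n-1}(1)) \<noteq> 0$.  Its determinant vanishes:
  $r_n(r_n + 2\<alpha>) = \<beta>_n R_n R_{n-1}$ (\<open>first_integral\<close>).

  The derivatives of $r_n$ and $R_n$ contain the neighbours $R_{n-1}$ and $R_{n+1}$ only in the
  products $\<beta>_n R_{n-1}$ and $\<beta>_{n+1} R_{n+1}$, and the constraint at $n$ and $n+1$ removes
  both.  With $u = r_n + \<alpha>$ and $W = 1 + 2t/R_n$ the result is
  \[ W' = W + \frac{W-1}{2t} - \frac{u W (W-1)}{t}, \qquad
     u' = \frac{u - (n + \<alpha>)}{W-1} + \frac{(u^2 - \<alpha>^2)(W-1)}{2t}, \]
  and eliminating $u$ gives the Painleve V equation (\<open>painleve_V_from_system\<close>).  The initial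
  values follow from $R_n(0) = 2n + 1 + 2\<alpha>$ and the differentiability of $R_n$ at $0$.
\<close>

section \<open>Orthogonal polynomials of an even functional\<close>

text \<open>
  The weight enters the algebra only through the functional $L(p) = \<integral> p\,w$.  Three-term
  recurrence, structure relation and first integral need just that $L$ is linear, positive on
  squares, even, and satisfies Pearson's equation.
\<close>

locale even_orthogonal =
  fixes L :: "real poly \<Rightarrow> real" and P :: "nat \<Rightarrow> real poly" and h :: "nat \<Rightarrow> real"
  assumes add: "L (p + q) = L p + L q"
    and smult: "L (smult c p) = c * L p"
    and pos: "p \<noteq> 0 \<Longrightarrow> 0 < L (p * p)"
    and even: "L (pcompose p [:0, -1:]) = L p"
    and degree_P: "degree (P n) = n"
    and lead_P: "lead_coeff (P n) = 1"
    and orth: "L (P m * P n) = (if m = n then h n else 0)"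
begin

lemma diff: "L (p - q) = L p - L q"
  using add[of "p - q" q] by simp

lemma zero [simp]: "L 0 = 0"
  using smult[of 0 0] by simp

lemma minus: "L (- p) = - L p"
  using diff[of 0 p] by simp

lemma h_pos: "0 < h n"
  using orth[of n n] pos[of "P n"] lead_P[of n] by (metis coeff_0 zero_neq_one)

lemma h_nz [simp]: "h n \<noteq> 0"
  using h_pos[of n] by simp

lemma coeff_P_top [simp]: "coeff (P n) n = 1"
  using lead_P[of n] degree_P[of n] by simp

lemma coeff_P_above: "n < i \<Longrightarrow> coeff (P n) i = 0"
  by (simp add: coeff_eq_0 degree_P)

text \<open>
  This is how every integral below is evaluated: against a polynomial of degree at most $n$,
  $P_n$ sees only the coefficient of $x^n$.  Stating the degree bound on coefficients makes the
  zero polynomial no exception.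
\<close>

lemma L_P_mult:
  assumes "\<And>i. n < i \<Longrightarrow> coeff q i = 0"
  shows "L (P n * q) = coeff q n * h n"
proof -
  \<comment> \<open>Strip the leading terms of \<open>q\<close> by multiples of \<open>P (m - 1)\<close>, \<open>P (m - 2)\<close>, \<open>...\<close>, all orthogonal to \<open>P n\<close>.\<close>
  have low: "L (P n * q) = 0" if "m \<le> n" "\<forall>i\<ge>m. coeff q i = 0" for m q
    using that
  proof (induction m arbitrary: q)
    case 0
    then have "q = 0" by (simp add: poly_eq_iff)
    then show ?case by simp
  next
    case (Suc m)
    define q' where "q' = q - smult (coeff q m) (P m)"
    have "coeff q' i = 0" if "i \<ge> m" for i
      using that Suc.prems(2) by (cases "i = m") (auto simp: q'_def coeff_P_above)
    then have "L (P n * q') = 0"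
      using Suc by auto
    moreover have "L (P n * smult (coeff q m) (P m)) = 0"
      using Suc.prems(1) by (simp add: smult orth)
    moreover have "P n * q = P n * q' + P n * smult (coeff q m) (P m)"
      by (simp add: q'_def algebra_simps)
    ultimately show ?case by (simp add: add)
  qed
  define q' where "q' = q - smult (coeff q n) (P n)"
  have "coeff q' i = 0" if "i \<ge> n" for i
    using that assms[of i] by (cases "i = n") (auto simp: q'_def coeff_P_above)
  then have "L (P n * q') = 0"
    using low[of n q'] by simp
  moreover have "P n * q = P n * q' + smult (coeff q n) (P n * P n)"
    by (simp add: q'_def algebra_simps)
  ultimately show ?thesis by (simp add: add smult orth)
qed

text \<open>
  All polynomial identities below are proved with this criterion: the difference $D$ of the two
  sides is an admissible test polynomial itself, so $L(D^2) = 0$.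
\<close>

lemma zero_if_orthogonal:
  assumes "\<And>i. n \<le> i \<Longrightarrow> coeff D i = 0"
    and "\<And>q. (\<And>i. n \<le> i \<Longrightarrow> coeff q i = 0) \<Longrightarrow> L (D * q) = 0"
  shows "D = 0"
  using assms(2)[of D] assms(1) pos[of D] by fastforce

text \<open>
  Reflection preserves $L$, hence it maps $P_n$ to another monic polynomial (up to sign) that is
  orthogonal to all lower degrees, and there is only one.
\<close>

lemma parity: "smult ((-1) ^ n) (pcompose (P n) [:0, -1:]) = P n"
proof -
  let ?r = "\<lambda>p :: real poly. pcompose p [:0, -1:]"
  define D where "D = smult ((-1) ^ n) (?r (P n)) - P n"
  have "D = 0"
  proof (rule zero_if_orthogonal[of n])
    fix i assume "n \<le> i"
    then show "coeff D i = 0"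
      by (cases "i = n")
        (auto simp: D_def coeff_pcompose_linear coeff_P_above simp flip: power_mult_distrib)
  next
    fix q :: "real poly" assume q: "\<And>i. n \<le> i \<Longrightarrow> coeff q i = 0"
    have "L (P n * q) = 0" using q by (subst L_P_mult) auto
    moreover have "L (?r (P n) * q) = L (?r (?r (P n) * q))" by (simp add: even)
    moreover have "?r (?r (P n) * q) = P n * ?r q"
      by (simp add: pcompose_mult flip: pcompose_assoc) (simp add: pcompose_pCons)
    moreover have "L (P n * ?r q) = 0"
      using q by (subst L_P_mult) (auto simp: coeff_pcompose_linear)
    ultimately show "L (D * q) = 0"
      by (simp add: D_def left_diff_distrib diff smult)
  qed
  then show ?thesis by (simp add: D_def)
qed

lemma coeff_P_pred: "coeff (P (Suc n)) n = 0"
proof -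
  have "coeff (smult ((-1) ^ Suc n) (pcompose (P (Suc n)) [:0, -1:])) n = coeff (P (Suc n)) n"
    by (simp only: parity)
  then have "(-1) ^ Suc n * ((-1) ^ n * coeff (P (Suc n)) n) = coeff (P (Suc n)) n"
    by (simp add: coeff_pcompose_linear)
  moreover have "(-1) ^ Suc n * ((-1) ^ n * c) = - c" for c :: real
    by (simp flip: mult.assoc power_add)
  ultimately show ?thesis by simp
qed

text \<open>
  The value $\<beta>_0 = 0$ removes the term in which the truncated index $0 - 1$ would occur, so the
  recurrence holds for all $n$.
\<close>

definition \<beta> :: "nat \<Rightarrow> real" where
  "\<beta> n = (if n = 0 then 0 else h n / h (n - 1))"

lemma P_0: "P 0 = 1"
  by (metis coeff_P_top degree_P degree_0_id one_pCons of_nat_1 coeff_pCons_0 degree_eq_zeroE)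

lemma recurrence: "[:0, 1:] * P n = P (Suc n) + smult (\<beta> n) (P (n - 1))"
proof (cases n)
  case 0
  have "P 1 = [:0, 1:]"
  proof (rule poly_eqI)
    fix i show "coeff (P 1) i = coeff [:0, 1:] i"
      using coeff_P_top[of 1] coeff_P_pred[of 0] coeff_P_above[of 1 i]
      by (cases i; cases "i - 1") (auto simp: coeff_pCons)
  qed
  then show ?thesis using 0 by (simp add: P_0 \<beta>_def)
next
  case (Suc m)
  define D where "D = [:0, 1:] * P n - P (Suc n) - smult (\<beta> n) (P m)"
  have "D = 0"
  proof (rule zero_if_orthogonal[of n])
    fix i assume "n \<le> i"
    then consider "i = n" | "i = Suc n" | "i > Suc n" by linarith
    then show "coeff D i = 0"
      by cases (auto simp: D_def coeff_P_above coeff_P_pred coeff_pCons Suc split: nat.split)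
  next
    fix q :: "real poly" assume q: "\<And>i. n \<le> i \<Longrightarrow> coeff q i = 0"
    have "L (P n * ([:0, 1:] * q)) = coeff q m * h n"
      using q by (subst L_P_mult) (auto simp: coeff_pCons Suc split: nat.split)
    moreover have "L (P (Suc n) * q) = 0"
      using q by (subst L_P_mult) auto
    moreover have "L (P m * q) = coeff q m * h m"
      using q by (subst L_P_mult) (auto simp: Suc)
    moreover have "D * q = P n * ([:0, 1:] * q) - P (Suc n) * q - smult (\<beta> n) (P m * q)"
      by (simp add: D_def algebra_simps)
    ultimately show "L (D * q) = 0"
      by (simp add: diff smult \<beta>_def Suc)
  qed
  then show ?thesis by (simp add: D_def Suc algebra_simps)
qed

text \<open>
  These moments give the derivative of $h_n$ in $t$, because $\<partial>w/\<partial>t = -x^2 w$.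
\<close>

lemma second_moment: "L (([:0, 1:] * P n) * ([:0, 1:] * P n)) = (\<beta> n + \<beta> (Suc n)) * h n"
proof -
  have "L (([:0, 1:] * P n) * ([:0, 1:] * P n))
      = L (P (Suc n) * P (Suc n)) + 2 * \<beta> n * L (P (Suc n) * P (n - 1)) + (\<beta> n)\<^sup>2 * L (P (n - 1) * P (n - 1))"
    unfolding recurrence by (simp add: distrib_left distrib_right add smult power2_eq_square mult.commute[of "P (n - Suc 0)" "P (Suc n)"])
  also have "\<dots> = (\<beta> n + \<beta> (Suc n)) * h n"
    by (cases n) (auto simp: orth \<beta>_def power2_eq_square field_simps)
  finally show ?thesis .
qed

end

text \<open>
  The weight solves a first-order linear differential equation with polynomial coefficients
  (Pearson's equation); integrated against a polynomial $q$ it becomes the identity \<open>pearson\<close>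
  between values of $L$.
\<close>

locale pearson_orthogonal = even_orthogonal +
  fixes \<alpha> t :: real
  assumes pearson: "L ([:1, 0, -1:] * pderiv q)
    = 2 * (\<alpha> + 1) * L ([:0, 1:] * q) + 2 * t * L ([:0, 1:] * [:1, 0, -1:] * q)"
begin

definition r :: "nat \<Rightarrow> real" where "r n = real n - 2 * t * \<beta> n"

definition R :: "nat \<Rightarrow> real" where
  "R n = 2 * real n + 1 + 2 * \<alpha> - 2 * t * (\<beta> n + \<beta> (Suc n))"

lemma R_eq: "R n = r n + r (Suc n) + 2 * \<alpha>"
  by (simp add: R_def r_def algebra_simps)

text \<open>
  The lowering relation in terms of $r_n$ and $R_n$.  With $D$ the difference of the two sides,
  the coefficients of $D$ from degree $n$ on vanish by parity and by the choice of $r_n$.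
  For a test polynomial $q$ of degree below $n$, Pearson's equation moves the derivative from $P_n$
  to $q$, and the recurrence turns $2t(1-x^2)\,x P_n$ into
  $2t(1-x^2)(P_{n+1} + \<beta>_n P_{n-1})$, whose second part cancels against the right-hand side.
  What remains is a multiple of the coefficient of $x^{n-1}$ in $q$, and the factor vanishes
  precisely because of the formula for $R_n$.
\<close>

lemma structure_relation:
  "[:1, 0, -1:] * pderiv (P (Suc m)) + smult (r (Suc m)) ([:0, 1:] * P (Suc m))
    = smult (\<beta> (Suc m)) ((smult (2 * t) [:1, 0, -1:] + [:R (Suc m):]) * P m)"
proof -
  define x s :: "real poly" where x_def: "x = [:0, 1:]" and s_def: "s = [:1, 0, -1:]"
  let ?n = "Suc m"
  define D where "D = s * pderiv (P ?n) + smult (r ?n) (x * P ?n)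
    - smult (\<beta> ?n * R ?n) (P m) - smult (2 * t * \<beta> ?n) (s * P m)"
  have cs: "coeff (s * p) i = coeff p i - (if i < 2 then 0 else coeff p (i - 2))" for p i
    by (auto simp: s_def coeff_pCons numeral_2_eq_2 split: nat.split)
  have cx: "coeff (x * p) i = (if i = 0 then 0 else coeff p (i - 1))" for p i
    by (auto simp: x_def coeff_pCons split: nat.split)
  have "D = 0"
  proof (rule zero_if_orthogonal[of ?n])
    fix i
    have D: "coeff D i = (real (Suc i) * coeff (P ?n) (Suc i) - (if i < 2 then 0 else real (Suc (i - 2)) * coeff (P ?n) (Suc (i - 2))))
      + r ?n * (if i = 0 then 0 else coeff (P ?n) (i - 1)) - \<beta> ?n * R ?n * coeff (P m) i
      - 2 * t * \<beta> ?n * (coeff (P m) i - (if i < 2 then 0 else coeff (P m) (i - 2)))"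
      unfolding D_def by (simp only: coeff_add coeff_diff coeff_smult cs cx coeff_pderiv)
    assume "?n \<le> i"
    then consider "i = ?n" | "i = Suc ?n" | "i > Suc ?n" by linarith
    then show "coeff D i = 0"
    proof cases
      case 1
      have "coeff (P m) (m - 1) = 0 \<or> m = 0"
        using coeff_P_pred[of "m - 1"] by (cases m) auto
      then show ?thesis unfolding D using 1 coeff_P_pred[of m]
        by (cases m) (auto simp: coeff_P_above numeral_2_eq_2)
    next
      case 2
      then show ?thesis
        unfolding D by (auto simp: coeff_P_above r_def numeral_2_eq_2 algebra_simps)
    next
      case 3
      then show ?thesis
        unfolding D by (auto simp: coeff_P_above)
    qed
  next
    fix q :: "real poly" assume q: "\<And>i. ?n \<le> i \<Longrightarrow> coeff q i = 0"
    \<comment> \<open>\<open>s * q\<close> has degree at most \<open>?n + 1\<close>, so \<open>P (?n + 1)\<close> meets its top coefficient.\<close>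
    have sq: "coeff (s * q) i = (if i = Suc ?n then - coeff q m else 0)" if "Suc ?n \<le> i" for i
      unfolding cs using that q[of i] q[of "i - 2"] by auto
    have "L (s * pderiv (P ?n * q)) = L (s * (P ?n * pderiv q)) + L (s * (pderiv (P ?n) * q))"
      by (simp add: pderiv_mult algebra_simps add)
    with pearson[of "P ?n * q", folded x_def s_def]
    have 1: "L (s * pderiv (P ?n) * q) = 2 * (\<alpha> + 1) * L (P ?n * (x * q))
        + 2 * t * L ((x * P ?n) * (s * q)) - L (P ?n * (s * pderiv q))"
      by (simp add: mult_ac)
    have 2: "L (P ?n * (x * q)) = coeff q m * h ?n"
      using q by (subst L_P_mult) (auto simp: cx)
    have 3: "L (P ?n * (s * pderiv q)) = - real m * coeff q m * h ?n"
      using q by (subst L_P_mult) (auto simp: cs coeff_pderiv)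
    have 4: "L (P m * q) = coeff q m * h m"
      using q by (subst L_P_mult) auto
    have 5: "L (P (Suc ?n) * (s * q)) = - coeff q m * h (Suc ?n)"
      using sq by (subst L_P_mult) auto
    have 6: "L ((x * P ?n) * (s * q)) = L (P (Suc ?n) * (s * q)) + \<beta> ?n * L (P m * (s * q))"
      by (simp only: recurrence[folded x_def]) (simp add: distrib_right add smult)
    have 7: "L (D * q) = L (s * pderiv (P ?n) * q) + r ?n * L (P ?n * (x * q))
        - \<beta> ?n * R ?n * L (P m * q) - 2 * t * \<beta> ?n * L (P m * (s * q))"
      by (simp only: D_def left_diff_distrib distrib_right diff add mult_smult_left smult)
        (simp add: mult_ac)
    have "h (Suc ?n) = \<beta> (Suc ?n) * h ?n" "h ?n = \<beta> ?n * h m"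
      by (simp_all add: \<beta>_def)
    then show "L (D * q) = 0"
      unfolding 7 1 2 3 4 6 5 R_def r_def by (simp only:) (simp add: algebra_simps)
  qed
  then show ?thesis
    by (simp add: D_def x_def s_def smult_add_left smult_add_right algebra_simps)
qed

text \<open>
  At the endpoint $x = 1$ the factor $1 - x^2$ kills the derivative, so the structure relation
  becomes an algebraic relation between two consecutive values $P_n(1)$.
\<close>

lemma at_one: "r n * poly (P n) 1 = \<beta> n * R n * poly (P (n - 1)) 1"
proof (cases n)
  case 0
  then show ?thesis by (simp add: r_def \<beta>_def)
next
  case (Suc m)
  then show ?thesis
    using arg_cong[OF structure_relation[of m], of "\<lambda>p. poly p 1"] by (simp add: algebra_simps)
qed

text \<open>
  The relations at $x = 1$ for the indices $m+1$ and $m$, the latter rewritten by the recurrence,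
  say that the vector $(P_{m+1}(1), P_m(1))$ is in the kernel of a $2 \times 2$ matrix.  That vector
  is not zero: as $\<beta>_k \<noteq> 0$ for $k \<ge> 1$, the recurrence would carry two consecutive zeros down to
  $P_0(1) = 1$.  The vanishing of the determinant is the claim.
\<close>

lemma first_integral: "r (Suc m) * (r (Suc m) + 2 * \<alpha>) = \<beta> (Suc m) * R (Suc m) * R m"
proof -
  let ?p = "\<lambda>n. poly (P n) 1"
  have rec: "?p n = ?p (Suc n) + \<beta> n * ?p (n - 1)" for n
    using arg_cong[OF recurrence[of n], of "\<lambda>p. poly p 1"] by simp
  have a: "r (Suc m) * ?p (Suc m) = \<beta> (Suc m) * R (Suc m) * ?p m"
    using at_one[of "Suc m"] by simp
  have b: "(r (Suc m) + 2 * \<alpha>) * ?p m = R m * ?p (Suc m)"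
    using at_one[of m] rec[of m] R_eq[of m] by algebra
  have nz: "?p m \<noteq> 0 \<or> ?p (Suc m) \<noteq> 0"
  proof (induction m)
    case 0
    then show ?case by (simp add: P_0)
  next
    case (Suc m)
    have "\<beta> (Suc m) \<noteq> 0" by (simp add: \<beta>_def)
    then show ?case using Suc rec[of "Suc m"] by auto
  qed
  have "(r (Suc m) * (r (Suc m) + 2 * \<alpha>) - \<beta> (Suc m) * R (Suc m) * R m) * ?p m = 0"
       "(r (Suc m) * (r (Suc m) + 2 * \<alpha>) - \<beta> (Suc m) * R (Suc m) * R m) * ?p (Suc m) = 0"
    using a b by algebra+
  then show ?thesis using nz by auto
qed

end

section \<open>Integrals against the deformed Jacobi weight\<close>

text \<open>
  The substitution $x = 2u - 1$ turns this into the Beta integral with both parameters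
  $\<alpha> + 1 > 0$.
\<close>

lemma jacobi_weight_integrable:
  assumes "\<alpha> > -1"
  shows "set_integrable lborel {-1..1} (\<lambda>x::real. (1 - x\<^sup>2) powr \<alpha>)"
proof -
  have "((\<lambda>u. u powr \<alpha> * (1 - u) powr \<alpha>) has_integral Beta (\<alpha> + 1) (\<alpha> + 1)) (cbox 0 1)"
    using has_integral_Beta_real[of "\<alpha> + 1" "\<alpha> + 1"] assms by simp
  from has_integral_affinity'[OF this, of "1/2" "1/2"]
  have "(\<lambda>x. (x / 2 + 1 / 2) powr \<alpha> * (1 - (x / 2 + 1 / 2)) powr \<alpha>) integrable_on {-1..1}"
    by (auto simp: integrable_on_def)
  from integrable_on_cmult_left[OF this, of "4 powr \<alpha>"]
  have "(\<lambda>x. 4 powr \<alpha> * ((x / 2 + 1 / 2) powr \<alpha> * (1 - (x / 2 + 1 / 2)) powr \<alpha>)) integrable_on {-1..1}"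
    by simp
  also have "?this \<longleftrightarrow> (\<lambda>x. (1 - x\<^sup>2) powr \<alpha>) integrable_on {-1..1}"
  proof (rule integrable_cong)
    fix x :: real assume "x \<in> {-1..1}"
    then have "4 powr \<alpha> * ((x / 2 + 1 / 2) powr \<alpha> * (1 - (x / 2 + 1 / 2)) powr \<alpha>)
      = (4 * ((x / 2 + 1 / 2) * (1 - (x / 2 + 1 / 2)))) powr \<alpha>"
      by (simp add: powr_mult)
    then show "4 powr \<alpha> * ((x / 2 + 1 / 2) powr \<alpha> * (1 - (x / 2 + 1 / 2)) powr \<alpha>) = (1 - x\<^sup>2) powr \<alpha>"
      by (simp add: algebra_simps power2_eq_square)
  qed
  finally have "(\<lambda>x::real. (1 - x\<^sup>2) powr \<alpha>) absolutely_integrable_on {-1..1}"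
    by (subst absolutely_integrable_on_iff_nonneg) auto
  then show ?thesis
    unfolding set_integrable_def by (subst (asm) integrable_completion) auto
qed

lemma continuous_mult_jacobi_integrable:
  assumes "\<alpha> > -1" and g: "continuous_on UNIV g"
  shows "set_integrable lborel {-1..1} (\<lambda>x::real. g x * (1 - x\<^sup>2) powr \<alpha>)"
proof -
  have "compact (g ` {-1..1})"
    using g by (intro compact_continuous_image) (auto intro: continuous_on_subset)
  then obtain B where B: "\<And>x. x \<in> {-1..1} \<Longrightarrow> \<bar>g x\<bar> \<le> B"
    by (force dest!: compact_imp_bounded simp: bounded_iff)
  have [measurable]: "g \<in> borel_measurable borel"
    using g by (rule borel_measurable_continuous_onI)
  have "set_integrable lborel {-1..1} (\<lambda>x::real. B * (1 - x\<^sup>2) powr \<alpha>)"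
    using jacobi_weight_integrable[OF assms(1)] by (intro set_integrable_mult_right)
  then show ?thesis
    unfolding set_integrable_def
    by (rule Bochner_Integration.integrable_bound)
      (auto intro!: AE_I2 mult_right_mono order_trans[OF B] simp: indicator_def abs_mult split: if_splits)
qed

definition weighted_integral :: "real \<Rightarrow> real \<Rightarrow> real poly \<Rightarrow> real" where
  "weighted_integral \<alpha> t p = (LBINT x:{-1..1}. poly p x * weight \<alpha> t x)"

lemma poly_weight_integrable:
  assumes "\<alpha> > -1"
  shows "set_integrable lborel {-1..1} (\<lambda>x. poly p x * weight \<alpha> t x)"
  using continuous_mult_jacobi_integrable[OF assms, of "\<lambda>x. poly p x * exp (- t * x\<^sup>2)"]
  by (simp add: weight_def mult_ac continuous_intros)

lemma weighted_integral_add: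
  assumes "\<alpha> > -1"
  shows "weighted_integral \<alpha> t (p + q) = weighted_integral \<alpha> t p + weighted_integral \<alpha> t q"
  using set_integral_add(2)[OF poly_weight_integrable[OF assms] poly_weight_integrable[OF assms]]
  by (simp add: weighted_integral_def distrib_right)

lemma weighted_integral_smult: "weighted_integral \<alpha> t (smult c p) = c * weighted_integral \<alpha> t p"
  by (simp add: weighted_integral_def mult.assoc)

lemma weighted_integral_even: "weighted_integral \<alpha> t (pcompose p [:0, -1:]) = weighted_integral \<alpha> t p"
proof -
  have "{x. - x \<in> {-1..1}} = {-1..1::real}" by auto
  then show ?thesis
    using set_integral_reflect[of "{-1..1}" "\<lambda>x. poly p x * weight \<alpha> t x"]
    by (simp add: weighted_integral_def poly_pcompose weight_def)
qed

text \<open>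
  A polynomial that is not zero has finitely many roots, and the weight is positive inside the interval.
\<close>

lemma weighted_integral_square_pos:
  assumes "\<alpha> > -1" "p \<noteq> 0"
  shows "0 < weighted_integral \<alpha> t (p * p)"
proof -
  let ?f = "\<lambda>x. indicator {-1..1} x *\<^sub>R (poly (p * p) x * weight \<alpha> t x)"
  have int: "integrable lborel ?f"
    using poly_weight_integrable[OF assms(1), of "p * p" t] by (simp add: set_integrable_def)
  have nn: "0 \<le> ?f x" for x
    by (auto simp: indicator_def weight_def)
  have "integral\<^sup>L lborel ?f \<noteq> 0"
  proof
    assume "integral\<^sup>L lborel ?f = 0"
    then have "AE x in lborel. ?f x = 0"
      using integral_nonneg_eq_0_iff_AE[OF int] nn by auto
    moreover have "AE x in lborel. x \<notin> {x. poly p x = 0}"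
      using poly_roots_finite[OF assms(2)]
      by (intro AE_not_in finite_imp_null_set_lborel)
    ultimately have "AE x in lborel. x \<notin> {-1<..<1::real}"
    proof eventually_elim
      case (elim x)
      show ?case
      proof
        assume x: "x \<in> {-1<..<1}"
        then have "x\<^sup>2 < 1" by (auto simp: abs_square_less_1 abs_less_iff)
        with elim x show False by (auto simp: weight_def)
      qed
    qed
    then have "emeasure lborel {-1<..<1::real} = 0"
      by (subst (asm) AE_iff_measurable[where N = "{-1<..<1}"]) auto
    then show False by simp
  qed
  moreover have "0 \<le> integral\<^sup>L lborel ?f"
    using nn by (intro integral_nonneg_AE) auto
  ultimately show ?thesis
    by (simp add: weighted_integral_def set_lebesgue_integral_def)
qed

text \<open>
  The difference of the two sides is the integral of the derivative of
  $(1-x^2)^{\<alpha>+1} e^{-tx^2} q(x)$, a function that vanishes at both endpoints since $\<alpha> > -1$.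
\<close>

lemma weighted_integral_pearson:
  assumes "\<alpha> > -1"
  shows "weighted_integral \<alpha> t ([:1, 0, -1:] * pderiv q)
    = 2 * (\<alpha> + 1) * weighted_integral \<alpha> t ([:0, 1:] * q)
      + 2 * t * weighted_integral \<alpha> t ([:0, 1:] * [:1, 0, -1:] * q)"
proof -
  let ?L = "weighted_integral \<alpha> t"
  let ?f = "\<lambda>x. (1 - x\<^sup>2) powr (\<alpha> + 1) * (exp (- t * x\<^sup>2) * poly q x)"
  define p where "p = [:1, 0, -1:] * pderiv q + (smult (- 2 * (\<alpha> + 1)) ([:0, 1:] * q)
    + smult (- 2 * t) ([:0, 1:] * [:1, 0, -1:] * q))"
  have "((\<lambda>x. poly p x * weight \<alpha> t x) has_integral (?f 1 - ?f (-1))) {-1..1}"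
  proof (rule fundamental_theorem_of_calculus_interior)
    show "continuous_on {-1..1} ?f"
      using assms by (intro continuous_intros continuous_on_powr') (auto simp: abs_square_le_1 abs_le_iff)
    fix x :: real assume x: "x \<in> {-1<..<1}"
    then have x2: "0 < 1 - x\<^sup>2" by (auto simp: abs_square_less_1 abs_less_iff)
    then have pw: "(1 - x\<^sup>2) powr (\<alpha> + 1) = (1 - x\<^sup>2) * (1 - x\<^sup>2) powr \<alpha>"
      by (simp add: powr_add)
    have "((\<lambda>x. (1 - x\<^sup>2) powr (\<alpha> + 1)) has_real_derivative (\<alpha> + 1) * (1 - x\<^sup>2) powr \<alpha> * (- 2 * x)) (at x)"
      using x2 by (auto intro!: derivative_eq_intros)
    moreover have "((\<lambda>x. exp (- t * x\<^sup>2) * poly q x) has_real_derivative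
        exp (- t * x\<^sup>2) * (poly (pderiv q) x - 2 * t * x * poly q x)) (at x)"
      by (auto intro!: derivative_eq_intros simp: algebra_simps)
    ultimately have "(?f has_real_derivative
        (\<alpha> + 1) * (1 - x\<^sup>2) powr \<alpha> * (- 2 * x) * (exp (- t * x\<^sup>2) * poly q x)
        + exp (- t * x\<^sup>2) * (poly (pderiv q) x - 2 * t * x * poly q x) * (1 - x\<^sup>2) powr (\<alpha> + 1)) (at x)"
      by (rule DERIV_mult)
    also have "(\<alpha> + 1) * (1 - x\<^sup>2) powr \<alpha> * (- 2 * x) * (exp (- t * x\<^sup>2) * poly q x)
        + exp (- t * x\<^sup>2) * (poly (pderiv q) x - 2 * t * x * poly q x) * (1 - x\<^sup>2) powr (\<alpha> + 1)
      = poly p x * weight \<alpha> t x"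
      unfolding pw p_def weight_def by (simp add: algebra_simps power2_eq_square)
    finally show "(?f has_vector_derivative poly p x * weight \<alpha> t x) (at x)"
      by (simp add: has_real_derivative_iff_has_vector_derivative)
  qed simp
  then have "?L p = 0"
    using set_borel_integral_eq_integral(2)[OF poly_weight_integrable[OF assms, of p t]]
    by (simp add: weighted_integral_def integral_unique)
  then show ?thesis
    unfolding p_def by (simp only: weighted_integral_add[OF assms] weighted_integral_smult)
qed

lemma abs_exp_diff_le:
  fixes a b K :: real
  assumes "a \<le> K" "b \<le> K"
  shows "\<bar>exp a - exp b\<bar> \<le> \<bar>a - b\<bar> * exp K"
proof -
  have *: "exp x - exp y \<le> (x - y) * exp K" if "y \<le> x" "x \<le> K" for x y :: real
  proof -
    have "exp x - exp y = exp x * (1 - exp (y - x))"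
      by (simp add: exp_diff right_diff_distrib)
    also have "1 - exp (y - x) \<le> x - y"
      using exp_ge_add_one_self[of "y - x"] by linarith
    then have "exp x * (1 - exp (y - x)) \<le> exp x * (x - y)"
      by (intro mult_left_mono) auto
    also have "\<dots> \<le> exp K * (x - y)"
      using that by (intro mult_right_mono) auto
    finally show ?thesis by (simp add: mult.commute)
  qed
  show ?thesis
    using *[of a b] *[of b a] assms by (cases "a \<le> b") (auto simp: abs_if)
qed

text \<open>
  Differentiation under the integral sign, in the form needed for $h_n$: the factor $g$ may depend
  on the parameter, and continuity of $g$ suffices, because the difference quotients of the weight
  are dominated by a multiple of $(1-x^2)^\<alpha>$, locally uniformly in $s$.
\<close>

lemma weight_difference_quotient_tendsto:
  fixes g :: "real \<Rightarrow> real \<Rightarrow> real"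
  assumes \<alpha>: "\<alpha> > -1" and g: "continuous_on UNIV (\<lambda>(s, x). g s x)"
  shows "((\<lambda>s. (LBINT x:{-1..1}. g s x * ((weight \<alpha> s x - weight \<alpha> t x) / (s - t))))
    \<longlongrightarrow> (LBINT x:{-1..1}. g t x * (- x\<^sup>2 * weight \<alpha> t x))) (at t)"
  unfolding tendsto_at_iff_sequentially comp_def
proof (intro allI impI)
  fix X :: "nat \<Rightarrow> real" assume X: "\<forall>i. X i \<in> UNIV - {t}" "X \<longlonglongrightarrow> t"
  define q where "q s x = (weight \<alpha> s x - weight \<alpha> t x) / (s - t)" for s x
  have gx: "continuous_on UNIV (g s)" for s
    using continuous_on_compose2[OF g, of UNIV "\<lambda>x. (s, x)"]
    by (auto simp: continuous_on_Pair)
  have gs: "isCont (\<lambda>s. g s x) t" for x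
    using continuous_on_compose2[OF g, of UNIV "\<lambda>s. (s, x)"]
    by (auto simp: continuous_on_Pair continuous_on_eq_continuous_at)
  have [measurable]: "g s \<in> borel_measurable borel" for s
    using gx by (rule borel_measurable_continuous_onI)
  have [measurable]: "weight \<alpha> s \<in> borel_measurable borel" for s
    unfolding weight_def[abs_def] by measurable
  have [measurable]: "q s \<in> borel_measurable borel" for s
    unfolding q_def[abs_def] by measurable
  obtain K where K: "\<And>i. \<bar>X i\<bar> \<le> K" "\<bar>t\<bar> \<le> K"
  proof -
    have "Bseq X" using X(2) by (intro convergent_imp_Bseq convergentI)
    then obtain K where "\<And>i. \<bar>X i\<bar> \<le> K" by (auto simp: Bseq_def)
    then show ?thesis using that[of "max K \<bar>t\<bar>"] by (simp add: le_max_iff_disj)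
  qed
  have "compact ((\<lambda>(s, x). g s x) ` ({-K..K} \<times> {-1..1}))"
    using g by (intro compact_continuous_image compact_Times) (auto intro: continuous_on_subset)
  then obtain B where B: "\<And>s x. s \<in> {-K..K} \<Longrightarrow> x \<in> {-1..1} \<Longrightarrow> \<bar>g s x\<bar> \<le> B"
    by (force dest!: compact_imp_bounded simp: bounded_iff)
  have q: "\<bar>q (X i) x\<bar> \<le> exp K * (1 - x\<^sup>2) powr \<alpha>" if x: "x \<in> {-1..1}" for i x
  proof -
    have x2: "x\<^sup>2 \<le> 1" using x by (auto simp: abs_square_le_1 abs_le_iff)
    have le: "- s * x\<^sup>2 \<le> K" if "\<bar>s\<bar> \<le> K" for s
    proof -
      have "- s * x\<^sup>2 \<le> \<bar>s\<bar> * 1" using x2 by (intro mult_mono) auto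
      then show ?thesis using that by simp
    qed
    have "\<bar>exp (- X i * x\<^sup>2) - exp (- t * x\<^sup>2)\<bar> \<le> \<bar>- X i * x\<^sup>2 - (- t * x\<^sup>2)\<bar> * exp K"
      using K by (intro abs_exp_diff_le le)
    also have "- X i * x\<^sup>2 - (- t * x\<^sup>2) = (t - X i) * x\<^sup>2" by (simp add: algebra_simps)
    also have "\<bar>(t - X i) * x\<^sup>2\<bar> * exp K \<le> \<bar>X i - t\<bar> * 1 * exp K"
      using x2 unfolding abs_mult by (intro mult_right_mono mult_mono) auto
    finally have "\<bar>exp (- X i * x\<^sup>2) - exp (- t * x\<^sup>2)\<bar> / \<bar>X i - t\<bar> \<le> exp K"
      using X(1) by (simp add: divide_le_eq mult.commute)
    then have "\<bar>exp (- X i * x\<^sup>2) - exp (- t * x\<^sup>2)\<bar> / \<bar>X i - t\<bar> * (1 - x\<^sup>2) powr \<alpha>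
        \<le> exp K * (1 - x\<^sup>2) powr \<alpha>"
      by (intro mult_right_mono) auto
    also have "\<bar>exp (- X i * x\<^sup>2) - exp (- t * x\<^sup>2)\<bar> / \<bar>X i - t\<bar> * (1 - x\<^sup>2) powr \<alpha> = \<bar>q (X i) x\<bar>"
      by (simp add: q_def weight_def abs_mult flip: right_diff_distrib)
    finally show ?thesis .
  qed
  have "(\<lambda>i. integral\<^sup>L lborel (\<lambda>x. indicator {-1..1} x *\<^sub>R (g (X i) x * q (X i) x)))
    \<longlonglongrightarrow> integral\<^sup>L lborel (\<lambda>x. indicator {-1..1} x *\<^sub>R (g t x * (- x\<^sup>2 * weight \<alpha> t x)))"
  proof (rule integral_dominated_convergence
      [where w = "\<lambda>x. indicator {-1..1} x *\<^sub>R (B * exp K * (1 - x\<^sup>2) powr \<alpha>)"])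
    show "integrable lborel (\<lambda>x. indicator {-1..1} x *\<^sub>R (B * exp K * (1 - x\<^sup>2) powr \<alpha>))"
      using set_integrable_mult_right[OF jacobi_weight_integrable[OF \<alpha>], of "B * exp K"]
      by (simp add: set_integrable_def)
    show "AE x in lborel. norm (indicator {-1..1} x *\<^sub>R (g (X i) x * q (X i) x))
        \<le> indicator {-1..1} x *\<^sub>R (B * exp K * (1 - x\<^sup>2) powr \<alpha>)" for i
    proof (rule AE_I2)
      fix x :: real
      have "\<bar>g (X i) x * q (X i) x\<bar> \<le> B * (exp K * (1 - x\<^sup>2) powr \<alpha>)" if x: "x \<in> {-1..1}"
        unfolding abs_mult
      proof (rule mult_mono)
        show *: "\<bar>g (X i) x\<bar> \<le> B" using x K(1)[of i] by (intro B) auto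
        then show "0 \<le> B" by (rule order_trans[rotated]) simp
      qed (use q[OF x] in auto)
      then show "norm (indicator {-1..1} x *\<^sub>R (g (X i) x * q (X i) x))
        \<le> indicator {-1..1} x *\<^sub>R (B * exp K * (1 - x\<^sup>2) powr \<alpha>)"
        by (auto simp: indicator_def mult.assoc)
    qed
    show "AE x in lborel. (\<lambda>i. indicator {-1..1} x *\<^sub>R (g (X i) x * q (X i) x))
        \<longlonglongrightarrow> indicator {-1..1} x *\<^sub>R (g t x * (- x\<^sup>2 * weight \<alpha> t x))"
    proof (rule AE_I2)
      fix x :: real
      have "((\<lambda>s. weight \<alpha> s x) has_real_derivative - x\<^sup>2 * weight \<alpha> t x) (at t)"
        unfolding weight_def by (auto intro!: derivative_eq_intros)
      then have "((\<lambda>s. q s x) \<longlongrightarrow> - x\<^sup>2 * weight \<alpha> t x) (at t)"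
        by (simp add: has_field_derivative_iff q_def)
      then have "((\<lambda>s. indicator {-1..1} x *\<^sub>R (g s x * q s x))
          \<longlongrightarrow> indicator {-1..1} x *\<^sub>R (g t x * (- x\<^sup>2 * weight \<alpha> t x))) (at t)"
        using gs[of x] by (intro tendsto_intros) (auto simp: isCont_def)
      then show "(\<lambda>i. indicator {-1..1} x *\<^sub>R (g (X i) x * q (X i) x))
        \<longlonglongrightarrow> indicator {-1..1} x *\<^sub>R (g t x * (- x\<^sup>2 * weight \<alpha> t x))"
        using X unfolding tendsto_at_iff_sequentially comp_def by blast
    qed
  qed measurable
  then show "(\<lambda>i. LBINT x:{-1..1}. g (X i) x * ((weight \<alpha> (X i) x - weight \<alpha> t x) / (X i - t)))
    \<longlonglongrightarrow> (LBINT x:{-1..1}. g t x * (- x\<^sup>2 * weight \<alpha> t x))"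
    by (simp only: set_lebesgue_integral_def q_def)
qed

section \<open>A first-order system equivalent to Painleve V\<close>

text \<open>
  The equation for $W'$ determines $u$ as long as $W \<noteq> 0, 1$, so a first-order system for $(W, u)$
  is a second-order equation for $W$.  To identify it with Painleve V, $W'$ is expressed through
  $u$ everywhere; what is left is an identity of rational functions in $t$, $W$ and $u$.
\<close>

lemma painleve_V_from_system:
  fixes W u :: "real \<Rightarrow> real"
  assumes t: "t \<noteq> 0" and W: "W t \<noteq> 0" "W t \<noteq> 1"
    and W': "\<forall>\<^sub>F s in nhds t. (W has_real_derivative W s + (W s - 1) / (2 * s) - u s * W s * (W s - 1) / s) (at s)"
    and u': "(u has_real_derivative (u t - a) / (W t - 1) + ((u t)\<^sup>2 - \<alpha>\<^sup>2) * (W t - 1) / (2 * t)) (at t)"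
  shows "painleve_V_at (\<alpha>\<^sup>2 / 2) (- 1 / 8) (a + 1 / 2) (- 1 / 2) W t"
proof -
  define F where "F s = W s + (W s - 1) / (2 * s) - u s * W s * (W s - 1) / s" for s
  define v where "v = (u t - a) / (W t - 1) + ((u t)\<^sup>2 - \<alpha>\<^sup>2) * (W t - 1) / (2 * t)"
  define G where "G = F t + (F t / (2 * t) - (W t - 1) / (2 * t\<^sup>2))
    - (v * W t * (W t - 1) / t + u t * F t * (2 * W t - 1) / t - u t * W t * (W t - 1) / t\<^sup>2)"
  have Wt: "(W has_real_derivative F t) (at t)"
    using eventually_nhds_x_imp_x[OF W'] by (simp add: F_def)
  have "(F has_real_derivative G) (at t)"
    unfolding F_def[abs_def] using t
    by (auto intro!: derivative_eq_intros Wt u'[folded v_def])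
      (simp add: G_def field_simps power2_eq_square)
  moreover have ev: "\<forall>\<^sub>F s in nhds t. deriv W s = F s"
    using W' by eventually_elim (simp add: F_def DERIV_imp_deriv)
  ultimately have W2: "(deriv W has_real_derivative G) (at t)"
    using DERIV_cong_ev[OF refl ev refl] by simp
  have 1: "\<forall>\<^sub>F s in nhds t. W field_differentiable (at s)"
    using W' by eventually_elim (auto simp: field_differentiable_def)
  have "G = (3 * W t - 1) * (F t)\<^sup>2 / (2 * W t * (W t - 1)) - F t / t
       + (W t - 1)\<^sup>2 / t\<^sup>2 * (\<alpha>\<^sup>2 / 2 * W t + (- 1 / 8) / W t)
       + (a + 1 / 2) * W t / t + (- 1 / 2) * W t * (W t + 1) / (W t - 1)"
  proof -
    define w i k where "w = W t - 1" and "i = 1 / t" and "k = 1 - u t * w * i"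
    have Ww: "W t = w + 1" and nz: "w \<noteq> 0" "w + 1 \<noteq> 0" using W by (auto simp: w_def)
    have i: "x / t = x * i" "x / (2 * t) = x * i / 2" "x / t\<^sup>2 = x * i\<^sup>2" "x / (2 * t\<^sup>2) = x * i\<^sup>2 / 2" for x
      using t by (auto simp: i_def field_simps power2_eq_square)
    have F: "F t = (w + 1) * k + w * i / 2"
      by (simp add: F_def Ww i k_def algebra_simps)
    have v: "v * W t * (W t - 1) / t = (u t - a) * (w + 1) * i + ((u t)\<^sup>2 - \<alpha>\<^sup>2) * w\<^sup>2 * (w + 1) * i\<^sup>2 / 2"
      unfolding v_def Ww i using nz(1) by (simp add: field_simps power2_eq_square)
    \<comment> \<open>The poles at \<open>W = 0\<close> cancel thanks to \<open>\<mu>\<^sub>2 = - 1 / 8\<close> ...\<close>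
    have 1: "(3 * W t - 1) * (F t)\<^sup>2 / (2 * W t * (W t - 1)) + w\<^sup>2 * i\<^sup>2 * ((- 1 / 8) / W t)
      = (3 * w + 2) / (2 * w) * ((w + 1) * k\<^sup>2) + (3 * w + 2) * k * i / 2 + w * i\<^sup>2 / 4"
      unfolding F Ww using nz by (simp add: divide_simps) algebra
    have k2: "k\<^sup>2 = 1 + w * (u t * i * (u t * w * i - 2))"
      by (simp add: k_def algebra_simps power2_eq_square)
    \<comment> \<open>... and those at \<open>W = 1\<close> thanks to \<open>\<mu>\<^sub>4 = - 1 / 2\<close>; the rest is a polynomial identity.\<close>
    have 2: "(3 * w + 2) / (2 * w) * ((w + 1) * k\<^sup>2) + (- 1 / 2) * W t * (W t + 1) / (W t - 1)
      = (w + 1) * (1 + (3 * w + 2) * (u t * i * (u t * w * i - 2)) / 2)"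
      unfolding k2 Ww using nz by (simp add: divide_simps) algebra
    have "G = ((w + 1) * (1 + (3 * w + 2) * (u t * i * (u t * w * i - 2)) / 2))
      + (3 * w + 2) * k * i / 2 + w * i\<^sup>2 / 4
      - F t * i + w\<^sup>2 * i\<^sup>2 * (\<alpha>\<^sup>2 / 2 * W t) + (a + 1 / 2) * W t * i"
      unfolding G_def v unfolding F Ww i k_def by (simp add: field_simps) algebra
    then show ?thesis
      using 1 2 unfolding i w_def[symmetric] distrib_left by linarith
  qed
  then show ?thesis
    using 1 W2 Wt ev unfolding painleve_V_at_def
    by (auto simp: field_differentiable_def DERIV_imp_deriv eventually_nhds_x_imp_x)
qed

section \<open>Evolution in the deformation parameter\<close>

text \<open>
  Each fixed $t$ is an instance of the algebraic setting, so its results hold at every $t$; the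
  derivatives in $t$ involve the whole family.
\<close>

locale jacobi_gauss_family =
  fixes \<alpha> :: real and P :: "nat \<Rightarrow> real \<Rightarrow> real poly" and h :: "nat \<Rightarrow> real \<Rightarrow> real"
  assumes \<alpha>: "\<alpha> > -1"
    and orthogonal: "monic_orthogonal (weight \<alpha> t) (\<lambda>k. P k t) (\<lambda>k. h k t)"
begin

sublocale at: pearson_orthogonal "weighted_integral \<alpha> t" "\<lambda>k. P k t" "\<lambda>k. h k t" \<alpha> t for t
proof
  show "weighted_integral \<alpha> t (P m t * P n t) = (if m = n then h n t else 0)" for m n
    using orthogonal[of t] by (simp add: monic_orthogonal_def weighted_integral_def)
  show "degree (P n t) = n" "lead_coeff (P n t) = 1" for n
    using orthogonal[of t] unfolding monic_orthogonal_def by blast+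
qed (use \<alpha> in \<open>auto simp: weighted_integral_add weighted_integral_smult weighted_integral_even
    weighted_integral_square_pos weighted_integral_pearson simp del: mult_pCons_left\<close>)

abbreviation b :: "nat \<Rightarrow> real \<Rightarrow> real" where "b \<equiv> rec_coeff h"

lemma \<beta>_eq: "at.\<beta> t n = b n t"
  by (simp add: at.\<beta>_def rec_coeff_def)

lemma R_eq: "at.R t n = R_fun \<alpha> h n t"
  by (simp add: at.R_def R_fun_def \<beta>_eq)

text \<open>
  The cross integral of $P_n(\cdot,s) P_n(\cdot,t)$ is $h_n(s)$ with the weight $w(\cdot,s)$ and
  $h_n(t)$ with the weight $w(\cdot,t)$, as both polynomials are monic.  Hence
  $h_n(s) - h_n(t) = \<integral> P_n(x,s) P_n(x,t) (w(x,s) - w(x,t))\,dx$, and differentiability of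
  $h_n$ follows from mere continuity of $P_n$.
\<close>

lemma norm_has_derivative:
  assumes cont: "continuous_on UNIV (\<lambda>(s, x). poly (P n s) x)"
  shows "(h n has_real_derivative - (b n t + b (Suc n) t) * h n t) (at t)"
proof -
  let ?g = "\<lambda>s x. poly (P n s) x * poly (P n t) x"
  have int: "set_integrable lborel {-1..1} (\<lambda>x. ?g s x * weight \<alpha> v x)" for s v
    using poly_weight_integrable[OF \<alpha>, of "P n s * P n t" v] by simp
  \<comment> \<open>\<open>P n v\<close> differs from \<open>P n s\<close> by terms of lower degree, orthogonal to \<open>P n s\<close>.\<close>
  have top: "weighted_integral \<alpha> s (P n s * P n v) = h n s" for s v
    using at.L_P_mult[of n "P n v" s] by (simp add: at.coeff_P_above)
  have "(h n s - h n t) / (s - t) = (LBINT x:{-1..1}. ?g s x * ((weight \<alpha> s x - weight \<alpha> t x) / (s - t)))" for s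
  proof -
    have "h n s - h n t = (LBINT x:{-1..1}. ?g s x * weight \<alpha> s x) - (LBINT x:{-1..1}. ?g s x * weight \<alpha> t x)"
      using top[of s t] top[of t s] by (simp add: weighted_integral_def mult.commute[of "poly (P n t) _"])
    also have "\<dots> = (LBINT x:{-1..1}. ?g s x * weight \<alpha> s x - ?g s x * weight \<alpha> t x)"
      by (rule set_integral_diff(2)[OF int int, symmetric])
    finally show ?thesis
      by (simp add: right_diff_distrib flip: set_integral_divide_zero)
  qed
  moreover have "((\<lambda>s. (LBINT x:{-1..1}. ?g s x * ((weight \<alpha> s x - weight \<alpha> t x) / (s - t))))
    \<longlongrightarrow> (LBINT x:{-1..1}. ?g t x * (- x\<^sup>2 * weight \<alpha> t x))) (at t)"
    using cont by (intro weight_difference_quotient_tendsto \<alpha>)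
      (auto simp: case_prod_unfold intro!: continuous_intros)
  moreover have "(LBINT x:{-1..1}. ?g t x * (- x\<^sup>2 * weight \<alpha> t x)) = - (b n t + b (Suc n) t) * h n t"
  proof -
    have "(LBINT x:{-1..1}. ?g t x * (- x\<^sup>2 * weight \<alpha> t x))
        = weighted_integral \<alpha> t (- (([:0, 1:] * P n t) * ([:0, 1:] * P n t)))"
      unfolding weighted_integral_def by (simp add: power2_eq_square mult_ac)
    also have "\<dots> = - (b n t + b (Suc n) t) * h n t"
      by (simp only: at.minus at.second_moment \<beta>_eq mult_minus_left)
    finally show ?thesis .
  qed
  ultimately show ?thesis
    by (simp only: has_field_derivative_iff)
qed

text \<open>
  The recurrence builds $P_n$ from lower polynomials and quotients of lower norms, and these norms
  are differentiable by \<open>norm_has_derivative\<close>, applied to the induction hypothesis.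
\<close>

lemma continuous_P: "continuous_on UNIV (\<lambda>(s, x). poly (P n s) x)"
proof (induction n rule: less_induct)
  case (less n)
  show ?case
  proof (cases n)
    case 0
    then show ?thesis by (simp add: at.P_0 case_prod_unfold)
  next
    case (Suc m)
    have IH: "continuous_on UNIV (\<lambda>(s, x). poly (P k s) x)" if "k \<le> m" for k
      using less[of k] that Suc by simp
    have "continuous_on UNIV (h k)" if "k \<le> m" for k
      using DERIV_isCont[OF norm_has_derivative[OF IH[OF that]]]
      by (simp add: continuous_at_imp_continuous_on)
    then have "continuous_on UNIV (b m)"
      unfolding rec_coeff_def[abs_def]
      by (cases m) (simp_all add: continuous_on_divide)
    then have "continuous_on UNIV (\<lambda>z. b m (fst z))"
      by (rule continuous_on_compose2) (simp_all add: continuous_on_fst continuous_on_id)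
    then have "continuous_on UNIV (\<lambda>z. snd z * poly (P m (fst z)) (snd z)
        - b m (fst z) * poly (P (m - 1) (fst z)) (snd z))"
      using IH[of m] IH[of "m - 1"] unfolding case_prod_unfold
      by (intro continuous_on_diff continuous_on_mult continuous_on_snd continuous_on_id) simp_all
    moreover have "poly (P n s) x = x * poly (P m s) x - b m s * poly (P (m - 1) s) x" for s x
      using arg_cong[OF at.recurrence[of m s], of "\<lambda>p. poly p x"] by (simp add: Suc \<beta>_eq)
    ultimately show ?thesis
      by (simp add: case_prod_unfold)
  qed
qed

text \<open>
  The logarithmic derivatives of $h_n$ and $h_{n-1}$ differ by
  $\<beta>_{n-1} - \<beta>_{n+1}$: the recurrence coefficients evolve by the Volterra lattice.
\<close>

lemma volterra: "(b n has_real_derivative b n t * (b (n - 1) t - b (Suc n) t)) (at t)"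
proof (cases n)
  case 0
  then show ?thesis by (simp add: rec_coeff_def[abs_def])
next
  case (Suc m)
  have "b n = (\<lambda>s. h (Suc m) s / h m s)"
    by (simp add: rec_coeff_def[abs_def] Suc)
  moreover have "((\<lambda>s. h (Suc m) s / h m s) has_real_derivative
      h (Suc m) t / h m t * (b m t - b (Suc (Suc m)) t)) (at t)"
    using norm_has_derivative[OF continuous_P, of "Suc m" t] norm_has_derivative[OF continuous_P, of m t]
    by (auto intro!: derivative_eq_intros simp: field_simps)
  ultimately show ?thesis by (simp add: Suc)
qed

section \<open>Closing the evolution by the first integral\<close>

definition r :: "nat \<Rightarrow> real \<Rightarrow> real" where "r n t = real n - 2 * t * b n t"

abbreviation R :: "nat \<Rightarrow> real \<Rightarrow> real" where "R \<equiv> R_fun \<alpha> h"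

lemma R_eq_r: "R n t = r n t + r (Suc n) t + 2 * \<alpha>"
  by (simp add: R_fun_def r_def algebra_simps)

lemma first_integral: "r n t * (r n t + 2 * \<alpha>) = b n t * R n t * R (n - 1) t"
proof (cases n)
  case 0
  then show ?thesis by (simp add: r_def rec_coeff_def)
next
  case (Suc m)
  then show ?thesis
    using at.first_integral[of t m] by (simp add: R_eq \<beta>_eq at.r_def r_def)
qed

lemma r_has_derivative: "(r n has_real_derivative b n t * (R (n - 1) t - R n t)) (at t)"
proof -
  have "(r n has_real_derivative - 2 * b n t - 2 * t * (b n t * (b (n - 1) t - b (Suc n) t))) (at t)"
    unfolding r_def[abs_def] by (auto intro!: derivative_eq_intros volterra)
  also have "- 2 * b n t - 2 * t * (b n t * (b (n - 1) t - b (Suc n) t)) = b n t * (R (n - 1) t - R n t)"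
    by (cases n) (auto simp: R_fun_def rec_coeff_def[of _ 0] algebra_simps)
  finally show ?thesis .
qed

lemma R_has_derivative:
  "(R n has_real_derivative b n t * (R (n - 1) t - R n t) + b (Suc n) t * (R n t - R (Suc n) t)) (at t)"
proof -
  have "R n = (\<lambda>s. r n s + r (Suc n) s + 2 * \<alpha>)"
    by (intro ext R_eq_r)
  moreover have "((\<lambda>s. r n s + r (Suc n) s + 2 * \<alpha>) has_real_derivative
      b n t * (R (n - 1) t - R n t) + b (Suc n) t * (R n t - R (Suc n) t) + 0) (at t)"
    using r_has_derivative[of n t] r_has_derivative[of "Suc n" t]
    by (intro DERIV_add DERIV_const) simp_all
  ultimately show ?thesis by simp
qed

lemma W_quotient_derivative:
  assumes "R n t \<noteq> 0"
    and R': "(R n has_real_derivative R') (at t)"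
  shows "(W_fun \<alpha> h n has_real_derivative 2 / R n t - 2 * t * R' / (R n t)\<^sup>2) (at t)"
proof -
  have "((\<lambda>s. 1 + 2 * s / R n s) has_real_derivative
      0 + (2 * R n t - 2 * t * R') / (R n t * R n t)) (at t)"
    using assms(1) by (intro DERIV_add DERIV_const DERIV_divide R') (auto intro!: derivative_eq_intros)
  moreover have "0 + (2 * R n t - 2 * t * R') / (R n t * R n t) = 2 / R n t - 2 * t * R' / (R n t)\<^sup>2"
    using assms(1) by (simp add: field_simps power2_eq_square)
  ultimately show ?thesis
    unfolding W_fun_def[abs_def] by simp
qed

text \<open>
  The derivative of $R_n$ involves $\<beta>_n R_{n-1}$ and $\<beta>_{n+1} R_{n+1}$.  The first integral at
  $n$ and at $n+1$ expresses both through $r_n$ and $R_n$, which closes the system.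
\<close>

lemma W_has_derivative:
  assumes t: "t \<noteq> 0" "R n t \<noteq> 0"
  defines "W \<equiv> W_fun \<alpha> h n"
  shows "(W has_real_derivative W t + (W t - 1) / (2 * t) - (r n t + \<alpha>) * W t * (W t - 1) / t) (at t)"
proof -
  define R' where "R' = b n t * (R (n - 1) t - R n t) + b (Suc n) t * (R n t - R (Suc n) t)"
  have b: "2 * t * (b (Suc n) t - b n t) = 1 + 2 * \<alpha> - R n t + 2 * r n t"
    by (simp add: R_fun_def r_def algebra_simps)
  have "R n t * R' = r n t * (r n t + 2 * \<alpha>) - r (Suc n) t * (r (Suc n) t + 2 * \<alpha>)
      + (b (Suc n) t - b n t) * (R n t)\<^sup>2"
    using first_integral[of n t] first_integral[of "Suc n" t]
    by (simp add: R'_def algebra_simps power2_eq_square)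
  also have "\<dots> = R n t * (2 * r n t + 2 * \<alpha> - R n t + (b (Suc n) t - b n t) * R n t)"
    using R_eq_r[of n t] by algebra
  finally have "R' = 2 * r n t + 2 * \<alpha> - R n t + (b (Suc n) t - b n t) * R n t"
    using t(2) by simp
  then have R': "2 * t * R' = 2 * t * (2 * r n t + 2 * \<alpha> - R n t) + (1 + 2 * \<alpha> - R n t + 2 * r n t) * R n t"
    unfolding b[symmetric] by algebra
  have "(W has_real_derivative 2 / R n t - 2 * t * R' / (R n t)\<^sup>2) (at t)"
    unfolding W_def R'_def by (rule W_quotient_derivative[OF t(2) R_has_derivative])
  also have "2 / R n t - 2 * t * R' / (R n t)\<^sup>2
      = W t + (W t - 1) / (2 * t) - (r n t + \<alpha>) * W t * (W t - 1) / t"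
    unfolding R' W_def W_fun_def using t
    by (simp add: field_simps power2_eq_square)
  finally show ?thesis .
qed

text \<open>
  The companion equation.  The shift by $\<alpha>$ makes
  $r_n(r_n + 2\<alpha>) = u^2 - \<alpha>^2$ even in $u$ and turns $W'$ into a simple function of $u$.
\<close>

lemma shifted_r_has_derivative:
  assumes t: "t \<noteq> 0" "R n t \<noteq> 0"
  defines "W \<equiv> W_fun \<alpha> h n" and "u \<equiv> \<lambda>s. r n s + \<alpha>"
  shows "(u has_real_derivative (u t - (real n + \<alpha>)) / (W t - 1) + ((u t)\<^sup>2 - \<alpha>\<^sup>2) * (W t - 1) / (2 * t)) (at t)"
proof -
  have "(u has_real_derivative b n t * (R (n - 1) t - R n t)) (at t)"
    unfolding u_def by (auto intro!: derivative_eq_intros r_has_derivative)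
  also have "b n t * (R (n - 1) t - R n t) = r n t * (r n t + 2 * \<alpha>) / R n t - (real n - r n t) * R n t / (2 * t)"
    unfolding first_integral using t by (simp add: r_def field_simps)
  also have "\<dots> = (u t - (real n + \<alpha>)) / (W t - 1) + ((u t)\<^sup>2 - \<alpha>\<^sup>2) * (W t - 1) / (2 * t)"
    unfolding u_def W_def W_fun_def using t by (simp add: field_simps power2_eq_square)
  finally show ?thesis .
qed

lemma isCont_R: "isCont (R n) t"
  using R_has_derivative by (rule DERIV_isCont)

lemma W_painleve_V:
  assumes t: "t \<noteq> 0" "R n t \<noteq> 0" "W_fun \<alpha> h n t \<noteq> 0"
  shows "painleve_V_at (\<alpha>\<^sup>2 / 2) (- 1 / 8) ((2 * real n + 1 + 2 * \<alpha>) / 2) (- 1 / 2) (W_fun \<alpha> h n) t"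
proof -
  have "\<forall>\<^sub>F s in nhds t. s \<noteq> 0" "\<forall>\<^sub>F s in nhds t. R n s \<noteq> 0"
    using t isCont_R[of t n]
    by (auto intro!: tendsto_imp_eventually_ne[where F = "nhds t"] filterlim_ident
        simp: isCont_def tendsto_at_iff_tendsto_nhds)
  then have "\<forall>\<^sub>F s in nhds t. (W_fun \<alpha> h n has_real_derivative
    W_fun \<alpha> h n s + (W_fun \<alpha> h n s - 1) / (2 * s)
      - (r n s + \<alpha>) * W_fun \<alpha> h n s * (W_fun \<alpha> h n s - 1) / s) (at s)"
    by eventually_elim (rule W_has_derivative)
  moreover have "W_fun \<alpha> h n t \<noteq> 1"
    using t by (simp add: W_fun_def)
  ultimately have "painleve_V_at (\<alpha>\<^sup>2 / 2) (- 1 / 8) (real n + \<alpha> + 1 / 2) (- 1 / 2) (W_fun \<alpha> h n) t"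
    using t shifted_r_has_derivative[of t n]
    by (intro painleve_V_from_system[where u = "\<lambda>s. r n s + \<alpha>"]) auto
  moreover have "real n + \<alpha> + 1 / 2 = (2 * real n + 1 + 2 * \<alpha>) / 2" by simp
  ultimately show ?thesis by simp
qed

lemma W_initial:
  assumes "2 * real n + 1 + 2 * \<alpha> \<noteq> 0"
  shows "W_fun \<alpha> h n 0 = 1"
    and "(W_fun \<alpha> h n has_real_derivative 2 / (2 * real n + 1 + 2 * \<alpha>)) (at 0)"
proof -
  have "R n 0 = 2 * real n + 1 + 2 * \<alpha>" by (simp add: R_fun_def)
  then show "(W_fun \<alpha> h n has_real_derivative 2 / (2 * real n + 1 + 2 * \<alpha>)) (at 0)"
    using W_quotient_derivative[OF _ R_has_derivative, of n 0] assms by simp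
qed (simp add: W_fun_def)

end

theorem theorem4p3:
  fixes \<alpha> :: real and n :: nat
    and P :: "nat \<Rightarrow> real \<Rightarrow> real poly" and h :: "nat \<Rightarrow> real \<Rightarrow> real"
  assumes "\<alpha> > -1"
    and "\<And>t. monic_orthogonal (weight \<alpha> t) (\<lambda>k. P k t) (\<lambda>k. h k t)"
  shows "(\<forall>t. t \<noteq> 0 \<and> R_fun \<alpha> h n t \<noteq> 0 \<and> W_fun \<alpha> h n t \<noteq> 0 \<longrightarrow>
            painleve_V_at (\<alpha>\<^sup>2 / 2) (- 1 / 8) ((2 * real n + 1 + 2 * \<alpha>) / 2) (- 1 / 2)
              (W_fun \<alpha> h n) t) \<and>
         (2 * real n + 1 + 2 * \<alpha> \<noteq> 0 \<longrightarrow>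
            W_fun \<alpha> h n 0 = 1 \<and>
            (W_fun \<alpha> h n has_real_derivative 2 / (2 * real n + 1 + 2 * \<alpha>)) (at 0))"
proof -
  interpret jacobi_gauss_family \<alpha> P h
    using assms by unfold_locales
  show ?thesis
    using W_painleve_V W_initial by blast
qed

end
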